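(* Let $q$ be a prime power, $n\ge1$, $\sigma$ a generator of $\mathrm{Gal}(\mathbb{F}_{q^n}/\mathbb{F}_q)$, and $L=ax+bx^{\sigma}+cx^{\sigma^2}+dx^{\sigma^3}$ with $a,b,c,d\in\mathbb{F}_{q^n}$, $d\neq0$ and $a\neq0$. Write the characteristic polynomial of $A_L$ as $x^3-\chi_2x^2+\chi_1x-\chi_0$. Then $L$ is a permutation polynomial of $\mathbb{F}_{q^n}$ if and only if $1-\chi_2+\chi_1-\chi_0\neq0$.
   Context: $C_L=\begin{pmatrix}0&0&-a/d\\1&0&-b/d\\0&1&-c/d\end{pmatrix}$ and $A_L=C_LC_L^{\sigma}\cdots C_L^{\sigma^{n-1}}$, where $C_L^{\sigma^i}$ denotes entrywise application of $\sigma^i$. A permutation polynomial is one inducing a bijection of $\mathbb{F}_{q^n}$. *)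

theory Defs
  imports
    "HOL-Library.Cardinality"
    "HOL-Algebra.Algebraic_Closure_Type"
    "HOL-Algebra.Generated_Groups"
    "HOL-Number_Theory.Prime_Powers"
    "Jordan_Normal_Form.Char_Poly"
begin

definition galois_group :: "'a::field set \<Rightarrow> ('a \<Rightarrow> 'a) monoid" where
  "galois_group K =
     \<lparr>carrier = {\<tau> \<in> ring_iso ring_of_type_algebra ring_of_type_algebra. \<forall>x\<in>K. \<tau> x = x},
      monoid.mult = (\<circ>), one = id\<rparr>"

definition permutation_polynomial :: "'a::field poly \<Rightarrow> bool" where
  "permutation_polynomial P \<longleftrightarrow> bij (poly P)"

text \<open>
  The expression \<open>x\<^sup>\<sigma>\<close> stands for \<open>\<sigma> x\<close>. An automorphism \<open>\<sigma>\<close> of a finite field over its subfield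
  of order \<open>q\<close> has the form \<open>x \<mapsto> x ^ (q ^ s)\<close>, where \<open>s\<close> is determined only modulo the degree of the
  extension, so \<open>a x + b x\<^sup>\<sigma> + \<dots>\<close> is determined as a polynomial only up to the function that it
  induces. The predicate below therefore admits every polynomial inducing that function.
\<close>

definition is_sigma_cubic :: "('a \<Rightarrow> 'a) \<Rightarrow> 'a \<Rightarrow> 'a \<Rightarrow> 'a \<Rightarrow> 'a \<Rightarrow> 'a::field poly \<Rightarrow> bool" where
  "is_sigma_cubic \<sigma> a b c d L \<longleftrightarrow>
     (\<forall>x. poly L x = a * x + b * \<sigma> x + c * (\<sigma> ^^ 2) x + d * (\<sigma> ^^ 3) x)"

definition C_mat :: "'a \<Rightarrow> 'a \<Rightarrow> 'a \<Rightarrow> 'a \<Rightarrow> 'a::field mat" where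
  "C_mat a b c d = mat_of_rows_list 3
     [[0, 0, - a / d],
      [1, 0, - b / d],
      [0, 1, - c / d]]"

definition A_mat :: "('a \<Rightarrow> 'a) \<Rightarrow> nat \<Rightarrow> 'a \<Rightarrow> 'a \<Rightarrow> 'a \<Rightarrow> 'a \<Rightarrow> 'a::field mat" where
  "A_mat \<sigma> n a b c d =
     foldr (*) (map (\<lambda>i. map_mat (\<sigma> ^^ i) (C_mat a b c d)) [0..<n]) (1\<^sub>m 3)"

end

theory Submission
  imports Defs "HOL-Number_Theory.Residues"
begin

text \<open>
  Multiplying a row vector \<open>(s m, s (m + 1), s (m + 2))\<close> by \<open>C\<^sub>L\<close> twisted by \<open>\<sigma> ^^ m\<close> shifts it by one
  along the recurrence whose \<open>m\<close>-th coefficients are the images of \<open>a, b, c, d\<close> under \<open>\<sigma> ^^ m\<close>. Hence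
  \<open>1\<close> is an eigenvalue of \<open>A\<^sub>L\<close> iff this recurrence has a nonzero \<open>n\<close>-periodic solution. A root \<open>x\<close>
  of \<open>L\<close> gives the solution \<open>m \<mapsto> (\<sigma> ^^ m) x\<close>; conversely, a periodic solution is turned into one of
  this form by an averaging argument as in Hilbert's Theorem 90.
\<close>

no_notation fps_nth (infixl \<open>$\<close> 75)

section \<open>Finite fields and the Frobenius map\<close>

text \<open>Multiplication by a nonzero \<open>x\<close> permutes the nonzero elements of
  \<open>K\<close>, so comparing their product before and after gives
  \<open>x ^ (card K - 1) = 1\<close>. The form covers both the subfield and the whole
  field.\<close>

lemma power_card_eq_same_on:
  fixes K :: "'a::field set"
  assumes "finite K" "0 \<in> K" and mult: "\<And>x y. x \<in> K \<Longrightarrow> y \<in> K \<Longrightarrow> x * y \<in> K"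
    and "x \<in> K"
  shows "x ^ card K = x"
proof (cases "x = 0")
  case True
  then show ?thesis using assms(1,2) by (auto simp: power_0_left card_gt_0_iff)
next
  case False
  have inj: "inj_on ((*) x) (K - {0})" using False by (auto simp: inj_on_def)
  have sub: "(*) x ` (K - {0}) \<subseteq> K - {0}" using False mult \<open>x \<in> K\<close> by auto
  have img: "(*) x ` (K - {0}) = K - {0}"
    by (rule endo_inj_surj[OF _ sub inj]) (use \<open>finite K\<close> in simp)
  have "\<Prod>(K - {0}) = (\<Prod>y\<in>K - {0}. x * y)"
    using prod.reindex[OF inj, of id] img by simp
  also have "\<dots> = x ^ card (K - {0}) * \<Prod>(K - {0})"
    by (simp add: prod.distrib)
  finally have "x ^ card (K - {0}) = 1"
    using \<open>finite K\<close> by simp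
  moreover have "card K = Suc (card (K - {0}))"
    using assms(1,2) by (rule card.remove)
  ultimately show ?thesis by simp
qed

text \<open>The elements of \<open>S\<close> are roots of X^m - X, whose leading coefficient
  survives because \<open>m > 1\<close>.\<close>

lemma card_power_eq_same_le:
  fixes S :: "'a::idom set"
  assumes "m > 1" and "\<And>x. x \<in> S \<Longrightarrow> x ^ m = x"
  shows "finite S \<and> card S \<le> m"
proof -
  let ?p = "monom 1 m - [:0, 1:] :: 'a poly"
  have deg: "degree ?p \<le> m"
    using \<open>m > 1\<close> by (intro degree_diff_le) (auto simp: degree_monom_eq)
  have "coeff ?p m = 1"
    using \<open>m > 1\<close> by (auto simp: coeff_pCons split: nat.splits)
  then have nz: "?p \<noteq> 0" by (metis coeff_0 zero_neq_one)
  have sub: "S \<subseteq> {x. poly ?p x = 0}"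
    using assms(2) by (auto simp: poly_monom)
  have "card {x. poly ?p x = 0} \<le> degree ?p"
    by (rule card_poly_roots_bound[OF nz])
  then show ?thesis
    using sub deg poly_roots_finite[OF nz] by (meson card_mono finite_subset le_trans)
qed

lemma power_CHAR_power_field_hom:
  fixes q :: nat
  assumes "prime CHAR('a::field)" and "q = CHAR('a) ^ k"
  shows "field_hom (\<lambda>x::'a. x ^ q)"
proof -
  have "q > 0" using assms by (simp add: prime_gt_0_nat)
  then show ?thesis
    using freshmans_dream'[OF assms] by unfold_locales (auto simp: power_mult_distrib)
qed

section \<open>Automorphisms\<close>

text \<open>Translates the record-based isomorphisms into \<open>field_hom\<close>, so that the
  simplification rules for homomorphisms apply to \<sigma>.\<close>

lemma galois_group_iff:
  "\<tau> \<in> carrier (galois_group K) \<longleftrightarrow> field_hom \<tau> \<and> bij \<tau> \<and> (\<forall>x\<in>K. \<tau> x = x)"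
proof -
  have "\<tau> \<in> ring_iso ring_of_type_algebra ring_of_type_algebra \<longleftrightarrow> field_hom \<tau> \<and> bij \<tau>"
  proof
    assume "\<tau> \<in> ring_iso ring_of_type_algebra ring_of_type_algebra"
    then have h: "bij \<tau>" "\<tau> 1 = 1" "\<tau> (x + y) = \<tau> x + \<tau> y" "\<tau> (x * y) = \<tau> x * \<tau> y" for x y
      by (auto simp: ring_iso_def Ring.ring_hom_def ring_of_type_algebra_def)
    have "\<tau> 0 = 0" using h(3)[of 0 0] by (metis add_0 add_right_cancel)
    then have "field_hom \<tau>" using h by unfold_locales auto
    then show "field_hom \<tau> \<and> bij \<tau>" using h(1) by simp
  next
    assume "field_hom \<tau> \<and> bij \<tau>"
    then interpret field_hom \<tau> by simp
    show "\<tau> \<in> ring_iso ring_of_type_algebra ring_of_type_algebra"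
      using \<open>field_hom \<tau> \<and> bij \<tau>\<close>
      by (auto simp: ring_iso_def Ring.ring_hom_def ring_of_type_algebra_def hom_add hom_mult)
  qed
  then show ?thesis by (auto simp: galois_group_def)
qed

lemma group_galois_group: "group (galois_group K)"
proof (rule groupI, goal_cases)
  case (1 x y)
  then show ?case
    by (auto simp: galois_group_def intro: ring_iso_set_trans)
next
  case 2
  show ?case by (auto simp: galois_group_def intro: ring_iso_set_refl)
next
  case (5 x)
  let ?R = "ring_of_type_algebra :: 'a ring"
  have x: "x \<in> ring_iso ?R ?R" "\<forall>y\<in>K. x y = y" using 5 by (auto simp: galois_group_def)
  have c: "carrier ?R = UNIV" by (simp add: ring_of_type_algebra_def)
  have b: "bij x" using 5 by (simp add: galois_group_iff)
  have "inv_into UNIV x \<in> ring_iso ?R ?R"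
    using ring_iso_set_sym[OF _ x(1)] ring_from_type_algebra c by metis
  moreover have "\<forall>y\<in>K. inv_into UNIV x y = y" using x(2) b by (metis bij_inv_eq_iff)
  ultimately have "inv_into UNIV x \<in> carrier (galois_group K)" by (simp add: galois_group_def)
  moreover have "inv_into UNIV x \<circ> x = id" using b by (simp add: bij_is_inj)
  ultimately show ?case by (auto simp: galois_group_def)
qed (auto simp: galois_group_def comp_assoc)

lemma galois_group_pow: "\<tau> [^]\<^bsub>galois_group K\<^esub> (k::nat) = \<tau> ^^ k"
  by (induction k) (simp_all add: galois_group_def nat_pow_def funpow_Suc_right del: funpow.simps(2))

lemma field_hom_funpow:
  fixes \<sigma> :: "'a::field \<Rightarrow> 'a"
  shows "field_hom \<sigma> \<Longrightarrow> field_hom (\<sigma> ^^ k)"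
proof (induction k)
  case 0
  show ?case by unfold_locales auto
next
  case (Suc k)
  interpret s: field_hom \<sigma> by (rule Suc.prems)
  interpret k: field_hom "\<sigma> ^^ k" by (rule Suc.IH[OF Suc.prems])
  show ?case by unfold_locales (auto simp: s.hom_add k.hom_add s.hom_mult k.hom_mult)
qed

section \<open>The order of a generator of the Galois group\<close>

text \<open>
  The order of \<open>\<sigma>\<close> is \<open>n\<close>. The polynomial with roots \<open>x ^ q ^ i\<close> is fixed by the Frobenius map, so it
  has coefficients in \<open>K\<close> and \<open>\<sigma> x\<close> is again one of its roots; as \<open>\<sigma>\<close> commutes with powers, \<open>\<sigma> ^^ n\<close> is
  the identity. Conversely, the Frobenius map lies in the group generated by \<open>\<sigma>\<close> and has order \<open>n\<close>.
\<close>

locale galois_generator =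
  fixes q n :: nat and K :: "'a::{field,finite} set" and \<sigma> :: "'a \<Rightarrow> 'a"
  assumes q: "primepow q" and n: "n \<ge> 1" and card: "CARD('a) = q ^ n"
    and subfield: "subfield K ring_of_type_algebra" and card_K: "card K = q"
    and gal: "\<sigma> \<in> carrier (galois_group K)"
    and gen: "generate (galois_group K) {\<sigma>} = carrier (galois_group K)"
begin

lemma q_gt_1: "q > 1"
  using primepow_gt_Suc_0[OF q] by simp

sublocale field_hom \<sigma>
  using gal by (simp add: galois_group_iff)

sublocale pow: field_hom "\<sigma> ^^ k" for k
  by (rule field_hom_funpow) unfold_locales

text \<open>The characteristic is a prime dividing \<open>q ^ n\<close>, hence the prime of which
  \<open>q\<close> is a power.\<close>

lemma frobenius_field_hom: "field_hom (\<lambda>x::'a. x ^ q)"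
proof -
  have pr: "prime CHAR('a)"
    using finite_imp_CHAR_pos[where ?'a = 'a] prime_CHAR_semidom[where ?'a = 'a] by simp
  obtain p k where pk: "prime p" "k > 0" "q = p ^ k"
    using q by (auto simp: primepow_def)
  have "CHAR('a) dvd p ^ (k * n)"
    using CHAR_dvd_CARD[where ?'a = 'a] card pk by (simp add: power_mult)
  then have "CHAR('a) = p"
    using pr pk(1) by (metis prime_dvd_power primes_dvd_imp_eq)
  then show ?thesis
    using power_CHAR_power_field_hom[OF pr] pk by simp
qed

lemma power_card: "(x::'a) ^ q ^ n = x"
  using power_card_eq_same_on[of "UNIV :: 'a set" x] card by simp

text \<open>By counting: \<open>K\<close> lies in the set of solutions, which has at most
  \<open>q = card K\<close> elements.\<close>

lemma mem_K_iff: "x \<in> K \<longleftrightarrow> x ^ q = x"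
proof -
  have sr: "subring K ring_of_type_algebra"
    using subfieldE(1)[OF subfield] .
  have "0 \<in> K" "\<And>x y. x \<in> K \<Longrightarrow> y \<in> K \<Longrightarrow> x * y \<in> K"
    using subringE(2,6)[OF sr] by (auto simp: ring_of_type_algebra_def)
  then have *: "x ^ q = x" if "x \<in> K" for x
    using power_card_eq_same_on[of K x] that card_K by simp
  let ?S = "{x::'a. x ^ q = x}"
  have "K \<subseteq> ?S" using * by auto
  moreover have "card ?S \<le> card K"
    using card_power_eq_same_le[OF q_gt_1, of ?S] card_K by auto
  ultimately have "K = ?S" by (intro card_seteq) auto
  then show ?thesis by auto
qed

lemma conjugate_eq_power: "\<exists>i. \<sigma> x = x ^ q ^ i"
proof -
  interpret fr: field_hom "\<lambda>x::'a. x ^ q" by (rule frobenius_field_hom)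
  interpret fp: map_poly_comm_ring_hom "\<lambda>x::'a. x ^ q" ..
  define P where "P = (\<Prod>i<n. [:- (x ^ q ^ i), 1:])"
  have "map_poly (\<lambda>x. x ^ q) P = (\<Prod>i<n. [:- (x ^ q ^ Suc i), 1:])"
    unfolding P_def fp.hom_prod
    by (intro prod.cong refl) (simp add: fr.hom_uminus map_poly_pCons_hom power_mult[symmetric] mult.commute)
  \<comment> \<open>The shift of exponents permutes the factors cyclically, since
    \<open>x ^ q ^ n = x\<close>.\<close>
  also have "\<dots> = P"
  proof -
    obtain m where m: "n = Suc m" using n by (cases n) auto
    have "P = [:- x, 1:] * (\<Prod>i<m. [:- (x ^ q ^ Suc i), 1:])"
      unfolding P_def m prod.lessThan_Suc_shift by simp
    moreover have "x ^ q ^ Suc m = x" using power_card m by simp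
    ultimately show ?thesis unfolding m prod.lessThan_Suc by (simp only: mult.commute)
  qed
  finally have "coeff P j ^ q = coeff P j" for j
    by (metis coeff_map_poly fr.hom_zero)
  then have "\<sigma> (coeff P j) = coeff P j" for j
    using gal by (simp add: mem_K_iff[symmetric] galois_group_iff)
  then have "map_poly \<sigma> P = P" by (intro poly_eqI) (simp add: coeff_map_poly)
  moreover have "poly P x = 0"
    using n by (auto simp: P_def poly_prod intro!: bexI[of _ 0])
  ultimately have "poly P (\<sigma> x) = 0" by (metis poly_map_poly hom_zero)
  then show ?thesis by (auto simp: P_def poly_prod)
qed

lemma funpow_n: "(\<sigma> ^^ n) x = x"
proof -
  obtain i where i: "\<sigma> x = x ^ q ^ i" using conjugate_eq_power by blast
  \<comment> \<open>The exponent \<open>i\<close> depends on \<open>x\<close>, but it serves along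
    the whole orbit because \<sigma> commutes with powers.\<close>
  have "(\<sigma> ^^ k) x = x ^ q ^ (i * k)" for k
    by (induction k) (simp_all add: hom_power i power_mult[symmetric] power_add[symmetric] add.commute)
  then have "(\<sigma> ^^ n) x = x ^ (q ^ n) ^ i" by (simp add: power_mult[symmetric] mult.commute)
  also have "\<dots> = x"
    by (induction i) (simp_all add: power_mult power_card)
  finally show ?thesis .
qed

lemma funpow_neq_id:
  assumes "0 < i" "i < n"
  shows "\<sigma> ^^ i \<noteq> id"
proof
  assume id: "\<sigma> ^^ i = id"
  interpret fr: field_hom "\<lambda>x::'a. x ^ q" by (rule frobenius_field_hom)
  have "inj (\<lambda>x::'a. x ^ q)" by (auto intro: injI)
  then have "bij (\<lambda>x::'a. x ^ q)" by (simp add: bij_def finite_UNIV_inj_surj)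
  then have "(\<lambda>x. x ^ q) \<in> generate (galois_group K) {\<sigma>}"
    unfolding gen galois_group_iff using frobenius_field_hom by (simp add: mem_K_iff)
  \<comment> \<open>In a finite group natural exponents suffice to describe the subgroup generated
    by \<sigma>.\<close>
  then obtain k :: nat where k: "(\<lambda>x. x ^ q) = \<sigma> ^^ k"
    using group.generate_pow_on_finite_carrier[OF group_galois_group _ gal]
    by (auto simp: galois_group_pow)
  have "((\<lambda>x::'a. x ^ q) ^^ i) x = x ^ q ^ i" for x
    by (induction i) (simp_all add: power_mult[symmetric] mult.commute)
  moreover have "(\<sigma> ^^ k) ^^ i = id"
    using id by (metis funpow_mult id_funpow mult.commute)
  ultimately have "(x::'a) ^ q ^ i = x" for x
    using k by (metis id_apply)
  \<comment> \<open>All \<open>q ^ n\<close> field elements would be fixed by the power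
    \<open>q ^ i\<close>, which is too small to allow this.\<close>
  then have "CARD('a) \<le> q ^ i"
    using card_power_eq_same_le[of "q ^ i" "UNIV :: 'a set"] q_gt_1 \<open>0 < i\<close>
    by (metis one_less_power)
  then show False
    using card q_gt_1 \<open>i < n\<close> by simp
qed

end

section \<open>Linear independence of characters\<close>

text \<open>Dedekind's argument: subtracting \<open>\<chi> k y\<close> times the relation at
  \<open>x\<close> from the relation at \<open>y * x\<close> cancels the term of \<open>k\<close>.
  By induction \<open>c j * (\<chi> j y - \<chi> k y) = 0\<close> for all \<open>y\<close>, and some
  \<open>y\<close> separates the two characters.\<close>

lemma characters_independent:
  fixes \<chi> :: "'i \<Rightarrow> 'b::monoid_mult \<Rightarrow> 'a::idom"
  assumes "finite I" "inj_on \<chi> I"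
    and "\<And>i. i \<in> I \<Longrightarrow> \<chi> i 1 = 1"
    and "\<And>i x y. i \<in> I \<Longrightarrow> \<chi> i (x * y) = \<chi> i x * \<chi> i y"
    and "\<And>x. (\<Sum>i\<in>I. c i * \<chi> i x) = 0"
    and "i \<in> I"
  shows "c i = 0"
  using assms
proof (induction I arbitrary: c i rule: finite_induct)
  case empty
  then show ?case by simp
next
  case (insert k I)
  have zero: "c k * \<chi> k x + (\<Sum>i\<in>I. c i * \<chi> i x) = 0" for x
    using insert.prems(4)[of x] insert.hyps by simp
  have I: "c j = 0" if "j \<in> I" for j
  proof -
    have "(\<Sum>i\<in>I. c i * (\<chi> i y - \<chi> k y) * \<chi> i x) = 0" for x y
    proof -
      have "(\<Sum>i\<in>I. c i * (\<chi> i y - \<chi> k y) * \<chi> i x)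
          = (\<Sum>i\<in>I. c i * \<chi> i (y * x)) - \<chi> k y * (\<Sum>i\<in>I. c i * \<chi> i x)"
        unfolding sum_distrib_left sum_subtractf[symmetric]
        by (intro sum.cong refl) (simp add: insert.prems(3) algebra_simps)
      also have "(\<Sum>i\<in>I. c i * \<chi> i (y * x)) = - (c k * (\<chi> k y * \<chi> k x))"
        using zero[of "y * x"] by (simp add: insert.prems(3) eq_neg_iff_add_eq_0 add.commute)
      also have "(\<Sum>i\<in>I. c i * \<chi> i x) = - (c k * \<chi> k x)"
        using zero[of x] by (simp add: eq_neg_iff_add_eq_0 add.commute)
      finally show ?thesis by (simp add: algebra_simps)
    qed
    then have "c j * (\<chi> j y - \<chi> k y) = 0" for y
      using insert.prems that
      by (intro insert.IH[of "\<lambda>i. c i * (\<chi> i y - \<chi> k y)" j]) auto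
    moreover have "\<chi> j \<noteq> \<chi> k"
      using insert.prems(1) insert.hyps(2) that by (auto simp: inj_on_def)
    ultimately show ?thesis by (auto simp: fun_eq_iff)
  qed
  moreover have "c k = 0"
    using zero[of 1] I insert.prems(2)[of k] by simp
  ultimately show ?case using insert.prems(5) by auto
qed

lemma funpow_left_inverse:
  fixes f g :: "'a \<Rightarrow> 'a"
  assumes "\<And>x. f (g x) = x"
  shows "(f ^^ i) ((g ^^ i) x) = x"
proof (induction i arbitrary: x)
  case (Suc i)
  have "(f ^^ Suc i) ((g ^^ Suc i) x) = f ((f ^^ i) ((g ^^ i) (g x)))"
    by (simp only: funpow.simps(2)[of _ f] funpow_Suc_right[of _ g] o_apply)
  then show ?case by (simp only: Suc assms)
qed simp

section \<open>The twisted recurrence\<close>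

definition twisted_solution :: "('a \<Rightarrow> 'a) \<Rightarrow> 'a \<Rightarrow> 'a \<Rightarrow> 'a \<Rightarrow> 'a \<Rightarrow> (nat \<Rightarrow> 'a::field) \<Rightarrow> bool" where
  "twisted_solution \<sigma> a b c d s \<longleftrightarrow>
     (\<forall>m. (\<sigma> ^^ m) a * s m + (\<sigma> ^^ m) b * s (m + 1) + (\<sigma> ^^ m) c * s (m + 2) + (\<sigma> ^^ m) d * s (m + 3) = 0)"

text \<open>The state of the third-order recurrence at \<open>m\<close>. Eigenvectors are columns,
  so the action on row vectors from the right is expressed below through transposed
  matrices.\<close>

definition window :: "(nat \<Rightarrow> 'a) \<Rightarrow> nat \<Rightarrow> 'a vec" where
  "window s m = vec 3 (\<lambda>i. s (m + i))"

lemma window_eq_iff: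
  "window s m = window s k \<longleftrightarrow> s m = s k \<and> s (m + 1) = s (k + 1) \<and> s (m + 2) = s (k + 2)"
  unfolding window_def vec_eq_iff by (auto simp: eval_nat_numeral less_Suc_eq)

context
  fixes \<sigma> :: "'a::field \<Rightarrow> 'a" and a b c d :: 'a
  assumes \<sigma>: "field_hom \<sigma>" and d: "d \<noteq> 0"
begin

interpretation pow: field_hom "\<sigma> ^^ k" for k
  by (rule field_hom_funpow[OF \<sigma>])

text \<open>Division by the conjugate of \<open>d\<close>; the coefficients are kept as images of
  quotients because these are the entries of the last column of the twisted
  \<open>C_mat\<close>.\<close>

lemma twisted_solution_step:
  assumes "twisted_solution \<sigma> a b c d s"
  shows "s (m + 3) =
    (\<sigma> ^^ m) (- a / d) * s m + (\<sigma> ^^ m) (- b / d) * s (m + 1) + (\<sigma> ^^ m) (- c / d) * s (m + 2)"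
proof -
  have nz: "(\<sigma> ^^ m) d \<noteq> 0" using d by simp
  have "(\<sigma> ^^ m) a * s m + (\<sigma> ^^ m) b * s (m + 1) + (\<sigma> ^^ m) c * s (m + 2)
      + (\<sigma> ^^ m) d * s (m + 3) = 0"
    using assms by (simp add: twisted_solution_def)
  then have "(\<sigma> ^^ m) d * s (m + 3)
      = - ((\<sigma> ^^ m) a * s m + (\<sigma> ^^ m) b * s (m + 1) + (\<sigma> ^^ m) c * s (m + 2))"
    by (simp only: eq_neg_iff_add_eq_0 add.commute)
  then have step: "s (m + 3)
      = - ((\<sigma> ^^ m) a * s m + (\<sigma> ^^ m) b * s (m + 1) + (\<sigma> ^^ m) c * s (m + 2)) / (\<sigma> ^^ m) d"
    using nz by (metis nonzero_mult_div_cancel_left)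
  show ?thesis
    unfolding step pow.hom_div pow.hom_uminus using nz by (simp add: field_simps)
qed

lemma twisted_solution_exists:
  "\<exists>s. twisted_solution \<sigma> a b c d s \<and> s 0 = x \<and> s 1 = y \<and> s 2 = z"
proof -
  \<comment> \<open>Primitive recursion on triples of consecutive terms realises the third-order
    recurrence.\<close>
  define t where "t = rec_nat (x, y, z)
    (\<lambda>m (u, v, w). (v, w, - ((\<sigma> ^^ m) a * u + (\<sigma> ^^ m) b * v + (\<sigma> ^^ m) c * w) / (\<sigma> ^^ m) d))"
  define s where "s m = fst (t m)" for m
  have t: "t m = (s m, s (m + 1), s (m + 2))" for m
    by (simp add: s_def t_def split: prod.splits)
  have "s (m + 3) = - ((\<sigma> ^^ m) a * s m + (\<sigma> ^^ m) b * s (m + 1) + (\<sigma> ^^ m) c * s (m + 2)) / (\<sigma> ^^ m) d" for m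
  proof -
    have "t (Suc m) = (s (m + 1), s (m + 2),
        - ((\<sigma> ^^ m) a * s m + (\<sigma> ^^ m) b * s (m + 1) + (\<sigma> ^^ m) c * s (m + 2)) / (\<sigma> ^^ m) d)"
      using t[of m] by (simp add: t_def)
    then show ?thesis using t[of "Suc m"] by (simp add: eval_nat_numeral)
  qed
  then have "twisted_solution \<sigma> a b c d s"
    using d by (simp add: twisted_solution_def)
  moreover have "t 0 = (x, y, z)" by (simp add: t_def)
  ultimately show ?thesis using t[of 0] by (auto simp: numeral_2_eq_2)
qed

text \<open>The first two rows of the transposed companion matrix shift the entries; the third is
  the recurrence.\<close>

lemma transpose_C_mat_window:
  assumes "twisted_solution \<sigma> a b c d s"
  shows "transpose_mat (map_mat (\<sigma> ^^ m) (C_mat a b c d)) *\<^sub>v window s m = window s (Suc m)"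
proof (rule eq_vecI)
  fix i assume "i < dim_vec (window s (Suc m))"
  then consider "i = 0" | "i = 1" | "i = 2" by (fastforce simp: window_def)
  then show "(transpose_mat (map_mat (\<sigma> ^^ m) (C_mat a b c d)) *\<^sub>v window s m) $ i = window s (Suc m) $ i"
    using twisted_solution_step[OF assms, of m]
    by cases (auto simp: C_mat_def mat_of_rows_list_def window_def scalar_prod_def
        sum.atLeast_Suc_lessThan eval_nat_numeral)
qed (simp add: C_mat_def mat_of_rows_list_def window_def)

lemma map_C_mat_carrier: "map_mat f (C_mat a b c d) \<in> carrier_mat 3 3"
  by (rule carrier_matI) (simp_all add: C_mat_def mat_of_rows_list_def)

lemma foldr_C_mat_carrier:
  "foldr (*) (map (\<lambda>i. map_mat (f i) (C_mat a b c d)) is) (1\<^sub>m 3) \<in> carrier_mat 3 3"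
  by (induction "is") (auto intro: mult_carrier_mat[OF map_C_mat_carrier])

lemma A_mat_carrier: "A_mat \<sigma> n a b c d \<in> carrier_mat 3 3"
  unfolding A_mat_def by (rule foldr_C_mat_carrier)

lemma transpose_A_mat_window:
  assumes "twisted_solution \<sigma> a b c d s"
  shows "transpose_mat (A_mat \<sigma> n a b c d) *\<^sub>v window s 0 = window s n"
proof -
  let ?C = "\<lambda>i. map_mat (\<sigma> ^^ i) (C_mat a b c d)"
  let ?P = "\<lambda>m. foldr (*) (map ?C [m..<n]) (1\<^sub>m 3)"
  note C = map_C_mat_carrier and P = foldr_C_mat_carrier
  have w: "window s m \<in> carrier_vec 3" for m by (simp add: window_def)
  \<comment> \<open>Induction on the first index, downwards from \<open>n\<close>: the leftmost
    factor of the product acts first after transposition.\<close>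
  have "transpose_mat (?P m) *\<^sub>v window s m = window s n" if "m \<le> n" for m
    using that
  proof (induction rule: inc_induct)
    case base
    show ?case using w by simp
  next
    case (step m)
    have "transpose_mat (?P m) *\<^sub>v window s m
        = (transpose_mat (?P (Suc m)) * transpose_mat (?C m)) *\<^sub>v window s m"
      using step.hyps transpose_mult[OF C P, of "\<sigma> ^^ m" "\<lambda>i. \<sigma> ^^ i" "[Suc m..<n]"]
      by (simp add: upt_conv_Cons)
    also have "\<dots> = transpose_mat (?P (Suc m)) *\<^sub>v (transpose_mat (?C m) *\<^sub>v window s m)"
      by (rule assoc_mult_mat_vec[of _ 3 3 _ 3]) (use C P w in simp_all)
    finally show ?case
      using transpose_C_mat_window[OF assms] step.IH by simp
  qed
  then show ?thesis by (simp add: A_mat_def)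
qed

text \<open>Every vector is the initial window of a solution, and the transposed product carries
  that window to the one at \<open>n\<close>. The bound \<open>m < 3\<close> says that the initial
  window is nonzero.\<close>

lemma eigenvalue_1_iff:
  "eigenvalue (transpose_mat (A_mat \<sigma> n a b c d)) 1 \<longleftrightarrow>
     (\<exists>s. twisted_solution \<sigma> a b c d s \<and> (\<exists>m. s m \<noteq> 0 \<and> m < 3) \<and> window s n = window s 0)"
proof
  assume "eigenvalue (transpose_mat (A_mat \<sigma> n a b c d)) 1"
  then obtain v where v: "v \<in> carrier_vec 3" "v \<noteq> 0\<^sub>v 3"
    "transpose_mat (A_mat \<sigma> n a b c d) *\<^sub>v v = v"
    using A_mat_carrier[of n] by (auto simp: eigenvalue_def eigenvector_def)
  obtain s where s: "twisted_solution \<sigma> a b c d s" "s 0 = v $ 0" "s 1 = v $ 1" "s 2 = v $ 2"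
    using twisted_solution_exists by metis
  have "window s 0 = v"
    using s v(1) by (intro eq_vecI) (auto simp: window_def eval_nat_numeral less_Suc_eq)
  moreover from this have "\<exists>m. s m \<noteq> 0 \<and> m < 3"
    using v(1,2) by (auto simp: window_def vec_eq_iff) metis
  ultimately show "\<exists>s. twisted_solution \<sigma> a b c d s \<and> (\<exists>m. s m \<noteq> 0 \<and> m < 3) \<and> window s n = window s 0"
    using s(1) v(3) transpose_A_mat_window[OF s(1)] by metis
next
  assume "\<exists>s. twisted_solution \<sigma> a b c d s \<and> (\<exists>m. s m \<noteq> 0 \<and> m < 3) \<and> window s n = window s 0"
  then obtain s m where s: "twisted_solution \<sigma> a b c d s" "s m \<noteq> 0" "m < 3" "window s n = window s 0"
    by blast
  then have "window s 0 $ m \<noteq> 0" by (simp add: window_def)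
  then have "window s 0 \<noteq> 0\<^sub>v 3" using s(3) by auto
  then show "eigenvalue (transpose_mat (A_mat \<sigma> n a b c d)) 1"
    using transpose_A_mat_window[OF s(1), of n] s(4) A_mat_carrier[of n]
    unfolding eigenvalue_def eigenvector_def
    by (intro exI[of _ "window s 0"]) (auto simp: window_def)
qed

end

section \<open>Periodic solutions of the recurrence and roots of the cubic\<close>

context galois_generator
begin

text \<open>The coefficients have period \<open>n\<close> because \<open>\<sigma> ^^ n\<close> is
  the identity, so the recurrence propagates the agreement of the two windows.\<close>

lemma twisted_solution_periodic:
  assumes "twisted_solution \<sigma> a b c d s" "d \<noteq> 0" "window s n = window s 0"
  shows "s (m + n) = s m"
proof -
  have "window s (m + n) = window s m"
  proof (induction m)
    case 0
    show ?case using assms(3) by simp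
  next
    case (Suc m)
    have "(\<sigma> ^^ (m + n)) x = (\<sigma> ^^ m) x" for x
      by (simp add: funpow_add funpow_n)
    then show ?case
      using Suc twisted_solution_step[OF field_hom_axioms assms(2,1), of m]
        twisted_solution_step[OF field_hom_axioms assms(2,1), of "m + n"]
      by (simp add: window_eq_iff eval_nat_numeral)
  qed
  then show ?thesis by (simp add: window_eq_iff)
qed

lemma twisted_solution_orbit:
  assumes "a * x + b * \<sigma> x + c * (\<sigma> ^^ 2) x + d * (\<sigma> ^^ 3) x = 0"
  shows "twisted_solution \<sigma> a b c d (\<lambda>m. (\<sigma> ^^ m) x)"
  unfolding twisted_solution_def
proof
  fix m
  have "(\<sigma> ^^ m) (a * x + b * \<sigma> x + c * (\<sigma> ^^ 2) x + d * (\<sigma> ^^ 3) x) = 0"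
    using assms by simp
  then show "(\<sigma> ^^ m) a * (\<sigma> ^^ m) x + (\<sigma> ^^ m) b * (\<sigma> ^^ (m + 1)) x
      + (\<sigma> ^^ m) c * (\<sigma> ^^ (m + 2)) x + (\<sigma> ^^ m) d * (\<sigma> ^^ (m + 3)) x = 0"
    unfolding pow.hom_add pow.hom_mult
    by (simp only: funpow_add o_apply funpow.simps One_nat_def id_apply)
qed

text \<open>
  The averaging is over the semilinear map \<open>s \<mapsto> (\<lambda>m. \<sigma>\<^sup>-\<^sup>1 (s (m + 1)))\<close>, whose \<open>n\<close>-th
  power is the identity: applied to a multiple \<open>l s\<close> it gives a fixed vector, that is, an orbit
  \<open>m \<mapsto> (\<sigma> ^^ m) x\<close>, and independence of characters provides an \<open>l\<close> for which it does not vanish.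
\<close>

lemma root_of_twisted_solution:
  assumes s: "twisted_solution \<sigma> a b c d s" and per: "\<And>m. s (m + n) = s m" and "s k \<noteq> 0"
  shows "\<exists>x. x \<noteq> 0 \<and> a * x + b * \<sigma> x + c * (\<sigma> ^^ 2) x + d * (\<sigma> ^^ 3) x = 0"
proof -
  \<comment> \<open>The inverse of \<sigma>, written as a power of \<sigma> so that it is visibly a
    field homomorphism.\<close>
  define \<tau> where "\<tau> = \<sigma> ^^ (n - 1)"
  interpret \<tau>: field_hom "\<tau> ^^ i" for i
    unfolding \<tau>_def by (intro field_hom_funpow field_hom_axioms)
  have \<sigma>\<tau>: "\<sigma> (\<tau> x) = x" and \<tau>\<sigma>: "\<tau> (\<sigma> x) = x" for x
    using funpow_n[of x] n by (cases n; simp add: \<tau>_def funpow_swap1)+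
  have \<sigma>\<tau>_pow: "(\<sigma> ^^ i) ((\<tau> ^^ i) x) = x" and \<tau>\<sigma>_pow: "(\<tau> ^^ i) ((\<sigma> ^^ i) x) = x" for i x
    by (rule funpow_left_inverse, simp add: \<sigma>\<tau> \<tau>\<sigma>)+
  \<comment> \<open>Independence of characters requires these powers to be distinct; a coincidence
    would make a power of \<sigma> with exponent strictly between 0 and \<open>n\<close> the
    identity.\<close>
  have inj: "inj_on (\<lambda>i. \<tau> ^^ i) {..<n}"
  proof (rule linorder_inj_onI')
    fix i j assume ij: "i \<in> {..<n}" "j \<in> {..<n}" "i < j"
    show "\<tau> ^^ i \<noteq> \<tau> ^^ j"
    proof
      assume "\<tau> ^^ i = \<tau> ^^ j"
      then have "(\<sigma> ^^ (j - i + i)) ((\<tau> ^^ i) x) = x" for x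
        using ij(3) \<sigma>\<tau>_pow[of j x] by simp
      then have "\<sigma> ^^ (j - i) = id"
        unfolding funpow_add by (auto simp: \<sigma>\<tau>_pow)
      moreover have "0 < j - i" "j - i < n" using ij by auto
      ultimately show False using funpow_neq_id by blast
    qed
  qed
  \<comment> \<open>The value at \<open>j\<close> of the sum of the first \<open>n\<close> powers of
    the semilinear map applied to \<open>l s\<close>; the root sought is
    \<open>y l 0\<close>.\<close>
  define y where "y l j = (\<Sum>i<n. (\<tau> ^^ i) (l * s (i + j)))" for l j
  have "\<sigma> (y l j) = y l (Suc j)" for l j
  proof -
    define g where "g i = \<sigma> ((\<tau> ^^ i) (l * s (i + j)))" for i
    have "\<sigma> (y l j) = (\<Sum>i<n. g i)"
      by (simp add: y_def g_def hom_sum)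
    \<comment> \<open>The index may be shifted cyclically: the terms at 0 and \<open>n\<close>
      agree, as \<open>\<tau> ^^ n\<close> is the identity and \<open>s\<close> has period
      \<open>n\<close>.\<close>
    also have "\<dots> = (\<Sum>i<n. g (Suc i))"
    proof -
      obtain m where m: "n = Suc m" using n by (cases n) auto
      have "(\<tau> ^^ n) x = x" for x
        using \<tau>\<sigma>_pow[of n x] by (simp add: funpow_n)
      then have "g n = g 0" using per[of j] by (simp add: g_def add.commute)
      then show ?thesis
        using sum.lessThan_Suc_shift[of g m] unfolding m by (simp add: add.commute)
    qed
    finally show ?thesis by (simp add: y_def g_def \<sigma>\<tau>)
  qed
  then have y: "(\<sigma> ^^ j) (y l 0) = y l j" for l j
    by (induction j) simp_all
  \<comment> \<open>Moved inside \<open>\<tau> ^^ i\<close>, the coefficient \<open>a\<close>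
    becomes \<open>(\<sigma> ^^ i) a\<close>, so each summand contains the recurrence at
    \<open>i\<close>.\<close>
  have "a * y l 0 + b * y l 1 + c * y l 2 + d * y l 3
      = (\<Sum>i<n. (\<tau> ^^ i) (l * ((\<sigma> ^^ i) a * s i + (\<sigma> ^^ i) b * s (i + 1)
          + (\<sigma> ^^ i) c * s (i + 2) + (\<sigma> ^^ i) d * s (i + 3))))" for l
    unfolding y_def sum_distrib_left sum.distrib[symmetric]
    by (intro sum.cong refl) (simp add: \<tau>.hom_add \<tau>.hom_mult \<tau>\<sigma>_pow algebra_simps)
  then have root: "a * y l 0 + b * y l 1 + c * y l 2 + d * y l 3 = 0" for l
    using s by (simp add: twisted_solution_def)
  have "\<exists>l. y l k \<noteq> 0"
  proof (rule ccontr)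
    assume "\<nexists>l. y l k \<noteq> 0"
    \<comment> \<open>A linear relation between characters in the variable \<open>l\<close>, in
      which the identity has coefficient \<open>s k\<close>.\<close>
    then have "(\<Sum>i<n. (\<tau> ^^ i) (s (i + k)) * (\<tau> ^^ i) l) = 0" for l
      by (simp add: y_def \<tau>.hom_mult mult.commute)
    then have "(\<tau> ^^ 0) (s (0 + k)) = 0"
      using n inj by (intro characters_independent[of "{..<n}" "\<lambda>i. \<tau> ^^ i" "\<lambda>i. (\<tau> ^^ i) (s (i + k))" 0])
        (auto simp: \<tau>.hom_mult)
    then show False using \<open>s k \<noteq> 0\<close> by simp
  qed
  then obtain l where "y l k \<noteq> 0" by blast
  then have "y l 0 \<noteq> 0" using y[where l = l and j = k] by auto
  moreover have "\<sigma> (y l 0) = y l 1" using y[where l = l and j = 1] by simp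
  ultimately show ?thesis using root[of l] y by metis
qed

end

section \<open>Kernel of the cubic and the characteristic polynomial at 1\<close>

text \<open>An additive map is injective iff its kernel is trivial, and on a finite field
  injectivity gives bijectivity.\<close>

lemma permutation_polynomial_iff_additive:
  fixes L :: "'a::{field,finite} poly"
  assumes "\<And>x y. poly L (x - y) = poly L x - poly L y"
  shows "permutation_polynomial L \<longleftrightarrow> (\<forall>x. poly L x = 0 \<longrightarrow> x = 0)"
proof -
  have "poly L 0 = 0" using assms[of 0 0] by simp
  then have "inj (poly L) \<longleftrightarrow> (\<forall>x. poly L x = 0 \<longrightarrow> x = 0)"
    unfolding inj_def using assms by (metis right_minus_eq)
  then show ?thesis
    unfolding permutation_polynomial_def bij_def using finite_UNIV_inj_surj[of "poly L"] by auto
qed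

theorem theorem15:
  fixes q n :: nat
    and K :: "'a::{field,finite} set"
    and \<sigma> :: "'a \<Rightarrow> 'a"
    and a b c d \<chi>\<^sub>0 \<chi>\<^sub>1 \<chi>\<^sub>2 :: 'a
    and L :: "'a poly"
  assumes "primepow q"
    and "n \<ge> 1"
    and "CARD('a) = q ^ n"
    and "subfield K ring_of_type_algebra"
    and "card K = q"
    and "\<sigma> \<in> carrier (galois_group K)"
    and "generate (galois_group K) {\<sigma>} = carrier (galois_group K)"
    and "d \<noteq> 0"
    and "a \<noteq> 0"
    and "is_sigma_cubic \<sigma> a b c d L"
    and "char_poly (A_mat \<sigma> n a b c d) = [:- \<chi>\<^sub>0, \<chi>\<^sub>1, - \<chi>\<^sub>2, 1:]"
  shows "permutation_polynomial L \<longleftrightarrow> 1 - \<chi>\<^sub>2 + \<chi>\<^sub>1 - \<chi>\<^sub>0 \<noteq> 0"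
proof -
  interpret galois_generator q n K \<sigma>
    using assms(1-7) by (intro galois_generator.intro)
  have L: "poly L x = a * x + b * \<sigma> x + c * (\<sigma> ^^ 2) x + d * (\<sigma> ^^ 3) x" for x
    using assms(10) by (simp add: is_sigma_cubic_def)
  have "poly L (x - y) = poly L x - poly L y" for x y
    unfolding L by (simp only: hom_minus pow.hom_minus) (simp add: algebra_simps)
  then have perm: "permutation_polynomial L \<longleftrightarrow> (\<forall>x. poly L x = 0 \<longrightarrow> x = 0)"
    by (rule permutation_polynomial_iff_additive)
  have A: "A_mat \<sigma> n a b c d \<in> carrier_mat 3 3"
    by (rule A_mat_carrier[OF field_hom_axioms \<open>d \<noteq> 0\<close>])
  \<comment> \<open>Vanishing of this value means that 1 is an eigenvalue; transposition keeps the
    characteristic polynomial.\<close>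
  have "1 - \<chi>\<^sub>2 + \<chi>\<^sub>1 - \<chi>\<^sub>0 = poly (char_poly (A_mat \<sigma> n a b c d)) 1"
    unfolding assms(11) by simp
  then have "1 - \<chi>\<^sub>2 + \<chi>\<^sub>1 - \<chi>\<^sub>0 = 0 \<longleftrightarrow> eigenvalue (transpose_mat (A_mat \<sigma> n a b c d)) 1"
    using eigenvalue_root_char_poly[of "transpose_mat (A_mat \<sigma> n a b c d)" 3 1] A by simp
  also have "\<dots> \<longleftrightarrow> (\<exists>x. poly L x = 0 \<and> x \<noteq> 0)"
    unfolding eigenvalue_1_iff[OF field_hom_axioms \<open>d \<noteq> 0\<close>]
  proof (intro iffI; elim exE conjE)
    fix s m assume "twisted_solution \<sigma> a b c d s" "s m \<noteq> 0" "window s n = window s 0"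
    then show "\<exists>x. poly L x = 0 \<and> x \<noteq> 0"
      using root_of_twisted_solution twisted_solution_periodic[OF _ \<open>d \<noteq> 0\<close>]
      unfolding L by metis
  next
    fix x assume "poly L x = 0" "x \<noteq> 0"
    \<comment> \<open>The orbit of the root starts at \<open>x\<close>, which is nonzero, and
      returns after \<open>n\<close> steps.\<close>
    then show "\<exists>s. twisted_solution \<sigma> a b c d s \<and> (\<exists>m. s m \<noteq> 0 \<and> m < 3) \<and> window s n = window s 0"
      using twisted_solution_orbit[of a x b c d] unfolding L
      by (intro exI[of _ "\<lambda>m. (\<sigma> ^^ m) x"])
        (auto simp: window_def funpow_add funpow_n funpow_swap1 intro!: exI[of _ 0])
  qed
  finally show ?thesis using perm by auto
qed

end
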